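(* Let $\Lambda_0>0$, $\alpha\in(0,1)$, $\gamma>0$, $\beta\in(0,1)$. Let $\lambda$ be the expected intensity of the fractional Hawkes process with these parameters, i.e. the function on $[0,\infty)$ with Laplace transform $$\tilde\lambda(s)=\frac{\Lambda_0}{s}\,\frac{\gamma+s^{\beta}}{(1-\alpha)\gamma+s^{\beta}},$$ and let $\mathbb{E}[N(t)]=\int_0^t\lambda(u)\,du$ be the expected number of events up to time $t$. Then, for all $t\ge0$, $$\mathbb{E}[N(t)]=\frac{\Lambda_0}{1-\alpha}\,t-\frac{\alpha\Lambda_0}{1-\alpha}\,t\,E_{\beta,2}^1\big((\alpha-1)\gamma t^\beta\big).$$
   Context: The Laplace transform of a function $f$ on $[0,\infty)$ is $\int_0^\infty e^{-st}f(t)\,dt$; $\lambda$ is the continuous function on $[0,\infty)$ whose Laplace transform equals $\tilde\lambda(s)$ for all sufficiently large real $s$. The number of events up to time $t$ of the fractional Hawkes process is denoted $N(t)$; its expectation is the integral of the expected intensity, $\mathbb{E}[N(t)]=\int_0^t\lambda(u)\,du$. The three-parameter Mittag-Leffler (Prabhakar) function is $E_{a,b}^c(z)=\frac{1}{\Gamma(c)}\sum_{k=0}^\infty\frac{\Gamma(c+k)\,z^k}{k!\,\Gamma(ak+b)}$ for $\mathrm{Re}(a)>0$, so that $E_{\beta,2}^1(z)=\sum_{k=0}^\infty\frac{z^k}{\Gamma(\beta k+2)}$. *)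

theory Defs
  imports "HOL-Analysis.Analysis"
begin

text \<open>
  The integral is the gauge integral: it covers both the Lebesgue integral and the
  conditionally convergent improper integral over the half-line.
\<close>

definition has_laplace :: "(real \<Rightarrow> real) \<Rightarrow> real \<Rightarrow> real \<Rightarrow> bool"
  where "has_laplace f L s \<longleftrightarrow> ((\<lambda>t. exp (- (s * t)) * f t) has_integral L) {0..}"

text \<open>
  Terms with \<open>a * k + b\<close> at a pole of the Gamma function vanish, because
  \<open>Gamma\<close> is \<open>0\<close> there and \<open>x / 0 = 0\<close>; this is the usual convention
  for the reciprocal Gamma function.  The series is meant for \<open>a\<close> with
  positive real part, and \<open>c\<close> not a pole.
\<close>

definition prabhakar :: "'a::Gamma \<Rightarrow> 'a \<Rightarrow> 'a \<Rightarrow> 'a \<Rightarrow> 'a"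
  where "prabhakar a b c z =
    1 / Gamma c * (\<Sum>k. Gamma (c + of_nat k) * z ^ k / (fact k * Gamma (a * of_nat k + b)))"

definition hawkes_laplace :: "real \<Rightarrow> real \<Rightarrow> real \<Rightarrow> real \<Rightarrow> real \<Rightarrow> real"
  where "hawkes_laplace \<Lambda>\<^sub>0 \<alpha> \<gamma> \<beta> s =
    \<Lambda>\<^sub>0 / s * ((\<gamma> + s powr \<beta>) / ((1 - \<alpha>) * \<gamma> + s powr \<beta>))"

text \<open>
  The values of \<open>lam\<close> at negative arguments are irrelevant, so the expected
  intensity is a predicate; it determines \<open>lam\<close> on the closed half-line.
\<close>

definition expected_intensity ::
  "real \<Rightarrow> real \<Rightarrow> real \<Rightarrow> real \<Rightarrow> (real \<Rightarrow> real) \<Rightarrow> bool"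
  where "expected_intensity \<Lambda>\<^sub>0 \<alpha> \<gamma> \<beta> lam \<longleftrightarrow>
    continuous_on {0..} lam \<and>
    (\<forall>\<^sub>F s in at_top. has_laplace lam (hawkes_laplace \<Lambda>\<^sub>0 \<alpha> \<gamma> \<beta> s) s)"

definition expected_events :: "(real \<Rightarrow> real) \<Rightarrow> real \<Rightarrow> real"
  where "expected_events lam t = integral {0..t} lam"

end

theory Submission imports Defs begin

text \<open>
  Both sides are continuous, of exponential order, and have the same Laplace transform, so they
  agree by Lerch's theorem.  The integral of \<open>lam\<close> is of exponential order although its Laplace
  integral may converge only conditionally: integrating by parts against the bounded primitive of
  \<open>exp (- (r * t)) * lam t\<close> shows it.  The right-hand side is transformed term by term; its
  power series is dominated by a geometric series times \<open>exp (r * t)\<close> because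
  \<open>x powr a \<le> Gamma (a + 1) * exp x\<close>.
\<close>

section \<open>Half-line integrals as limits, elementary Laplace transforms and the Gamma
  integral\<close>

text \<open>The gauge integral over an unbounded set quantifies over all boxes containing a large
  ball. The extension of \<open>f\<close> by zero contributes nothing to the left of
  \<open>a\<close>, so only the right endpoint of the box matters. Nothing absolute is needed, so
  conditionally convergent integrals are covered.\<close>

lemma has_integral_atLeast_iff_tendsto:
  fixes f :: "real \<Rightarrow> real"
  assumes int: "\<And>T. f integrable_on {a..T}"
  shows "(f has_integral L) {a..} \<longleftrightarrow> ((\<lambda>T. integral {a..T} f) \<longlongrightarrow> L) at_top"
proof -
  let ?g = "\<lambda>x. if x \<in> {a..} then f x else 0"
  have inter: "{a..} \<inter> {u..v} = {max a u..v}" for u v :: real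
    by auto
  have int': "f integrable_on {max a u..v}" for u v
    by (rule integrable_on_subinterval[OF int[of v]]) auto
  have g_int: "?g integrable_on cbox u v" for u v
    using int'[of u v] integrable_restrict_Int[of "{a..}" f "{u..v}"] by (simp add: inter)
  have g_eq: "integral (cbox u v) ?g = integral {a..v} f" if "u \<le> a" for u v
    using that integral_restrict_Int[of "{u..v}" "{a..}" f] by (simp add: inter max_absorb1)
  have "(\<forall>e>0. \<exists>B>0. \<forall>u v. ball 0 B \<subseteq> cbox u v \<longrightarrow> norm (integral (cbox u v) ?g - L) < e)
    \<longleftrightarrow> ((\<lambda>T. integral {a..T} f) \<longlongrightarrow> L) at_top" (is "?lhs \<longleftrightarrow> ?rhs")
  proof
    assume lhs: ?lhs
    show ?rhs
      unfolding tendsto_iff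
    proof (intro allI impI)
      fix e :: real assume "e > 0"
      with lhs obtain B where B: "B > 0"
        "\<And>u v. ball 0 B \<subseteq> cbox u v \<Longrightarrow> norm (integral (cbox u v) ?g - L) < e" by metis
      have "dist (integral {a..T} f) L < e" if "T \<ge> B" for T
      proof -
        \<comment> \<open>The left endpoint lies below \<open>- B\<close>, so that the box covers
          the ball, and below \<open>a\<close>, so that \<open>g_eq\<close> applies.\<close>
        have "ball 0 B \<subseteq> cbox (min a (- B)) T" using that by (auto simp: dist_real_def)
        from B(2)[OF this] show ?thesis by (subst (asm) g_eq) (auto simp: dist_norm)
      qed
      thus "\<forall>\<^sub>F T in at_top. dist (integral {a..T} f) L < e"
        by (auto simp: eventually_at_top_linorder)
    qed
  next
    assume rhs: ?rhs
    show ?lhs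
    proof (intro allI impI)
      fix e :: real assume "e > 0"
      with rhs obtain B where B: "\<And>T. T \<ge> B \<Longrightarrow> dist (integral {a..T} f) L < e"
        unfolding tendsto_iff eventually_at_top_linorder by metis
      \<comment> \<open>The three entries make the radius positive, force the box to start left of
        \<open>a\<close>, and force it to end beyond \<open>B\<close>.\<close>
      let ?B = "max 1 (max \<bar>a\<bar> \<bar>B\<bar>)"
      have "norm (integral (cbox u v) ?g - L) < e" if "ball 0 ?B \<subseteq> cbox u v" for u v
      proof -
        have "ball (0::real) ?B = {- ?B <..< ?B}" by (simp add: ball_eq_greaterThanLessThan)
        with that have "{- ?B <..< ?B} \<subseteq> {u..v}" by simp
        hence "u \<le> - ?B" "?B \<le> v"
          using greaterThanLessThan_subseteq_atLeastAtMost_iff[of "- ?B" ?B u v] by auto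
        hence "u \<le> a" "v \<ge> B" by auto
        thus ?thesis using B[of v] by (subst g_eq) (auto simp: dist_norm)
      qed
      thus "\<exists>B>0. \<forall>u v. ball 0 B \<subseteq> cbox u v \<longrightarrow> norm (integral (cbox u v) ?g - L) < e"
        by (intro exI[of _ ?B]) auto
    qed
  qed
  thus ?thesis using g_int by (subst has_integral_alt') auto
qed

lemma has_laplace_iff_tendsto:
  assumes "continuous_on {0..} f"
  shows "has_laplace f L s \<longleftrightarrow> ((\<lambda>T. integral {0..T} (\<lambda>t. exp (- (s * t)) * f t)) \<longlongrightarrow> L) at_top"
  unfolding has_laplace_def
  by (intro has_integral_atLeast_iff_tendsto integrable_continuous_interval continuous_intros
        continuous_on_subset[OF assms]) auto

lemma has_laplace_diff:
  assumes "has_laplace f L s" "has_laplace g M s"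
  shows "has_laplace (\<lambda>t. f t - g t) (L - M) s"
  using has_integral_diff[OF assms[unfolded has_laplace_def]]
  by (simp add: has_laplace_def algebra_simps)

lemma has_laplace_mult_right:
  assumes "has_laplace f L s"
  shows "has_laplace (\<lambda>t. c * f t) (c * L) s"
  using has_integral_mult_right[OF assms[unfolded has_laplace_def], of c]
  by (simp add: has_laplace_def algebra_simps)

lemma has_laplace_cong:
  assumes "\<And>t. t \<ge> 0 \<Longrightarrow> f t = g t"
  shows "has_laplace f L s \<longleftrightarrow> has_laplace g L s"
  unfolding has_laplace_def by (rule has_integral_cong) (simp add: assms)

text \<open>This is the Gamma integral under the substitution of \<open>s * t\<close> for
  \<open>t\<close>. The stretching is done on \<open>{0..T}\<close> and the limit taken afterwards;
  it leaves a factor \<open>s powr a\<close>, which is divided out at the end.\<close>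

lemma has_laplace_powr:
  assumes "a > - 1" "s > 0"
  shows "has_laplace (\<lambda>t. t powr a) (Gamma (a + 1) / s powr (a + 1)) s"
proof -
  let ?f = "\<lambda>t. t powr a / exp t"
  have f: "(?f has_integral Gamma (a + 1)) {0..}"
    using Gamma_integral_real[of "a + 1"] assms by simp
  have int: "?f integrable_on {0..T}" for T
    by (rule integrable_on_subinterval[OF has_integral_integrable[OF f]]) auto
  have img: "(\<lambda>x. x / s) ` {0..s * T} = {0..T}" for T
    using assms by (force simp: field_simps image_iff)
  have st: "((\<lambda>t. ?f (s * t)) has_integral integral {0..s * T} ?f / s) {0..T}" for T
    using has_integral_stretch_real[OF integrable_integral[OF int], of s "s * T"] assms
    unfolding img by simp
  have "((\<lambda>T. integral {0..T} ?f) \<longlongrightarrow> Gamma (a + 1)) at_top"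
    using f has_integral_atLeast_iff_tendsto[OF int] by simp
  hence "((\<lambda>T. integral {0..s * T} ?f) \<longlongrightarrow> Gamma (a + 1)) at_top"
    by (rule filterlim_compose)
      (use assms in \<open>auto intro!: filterlim_tendsto_pos_mult_at_top filterlim_ident\<close>)
  hence "((\<lambda>T. integral {0..s * T} ?f / s) \<longlongrightarrow> Gamma (a + 1) / s) at_top"
    by (intro tendsto_intros) (use assms in auto)
  hence "((\<lambda>t. ?f (s * t)) has_integral Gamma (a + 1) / s) {0..}"
    using st by (subst has_integral_atLeast_iff_tendsto) (auto simp: has_integral_iff)
  from has_integral_mult_right[OF this, of "1 / s powr a"] show ?thesis
    unfolding has_laplace_def using assms
    by (elim has_integral_eq_rhs[OF has_integral_eq, rotated])
      (auto simp: powr_mult powr_add exp_minus field_simps)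
qed

text \<open>\<open>x powr a * exp (- x)\<close> is at most the tail of the Gamma integral beyond \<open>x\<close>.\<close>

lemma powr_le_Gamma_mult_exp:
  fixes a x :: real
  assumes "a \<ge> 0" "x \<ge> 0"
  shows "x powr a \<le> Gamma (a + 1) * exp x"
proof -
  have "((\<lambda>t. exp (- t)) has_integral exp (- x)) {x..}"
    using has_integral_exp_minus_to_infinity[of 1 x] by simp
  hence "((\<lambda>t. x powr a * exp (- t)) has_integral x powr a * exp (- x)) {x..}"
    by (rule has_integral_mult_right)
  hence 1: "((\<lambda>t. if t \<in> {x..} then x powr a * exp (- t) else 0) has_integral x powr a * exp (- x)) {0..}"
    by (subst has_integral_restrict) (use assms in auto)
  have "((\<lambda>t. t powr a / exp t) has_integral Gamma (a + 1)) {0..}"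
    using Gamma_integral_real[of "a + 1"] assms by simp
  with 1 have "x powr a * exp (- x) \<le> Gamma (a + 1)"
    by (rule has_integral_le)
      (use assms in \<open>auto simp: exp_minus divide_inverse intro!: mult_right_mono powr_mono2\<close>)
  thus ?thesis by (simp add: exp_minus field_simps)
qed

section \<open>Growth and Laplace transform of a primitive\<close>

text \<open>Integration by parts on a bounded interval. With \<open>c = r\<close> it recovers the
  integral of \<open>f\<close> from that of its damped version; with \<open>c = - s\<close> it
  yields the transform of a primitive.\<close>

lemma integral_exp_mult_eq:
  fixes f :: "real \<Rightarrow> real"
  assumes cont: "continuous_on {0..} f" and "T \<ge> 0"
  shows "integral {0..T} (\<lambda>t. exp (c * t) * f t) =
    exp (c * T) * integral {0..T} f - c * integral {0..T} (\<lambda>t. exp (c * t) * integral {0..t} f)"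
proof -
  let ?F = "\<lambda>t. integral {0..t} f"
  have contT: "continuous_on {0..T} f" by (rule continuous_on_subset[OF cont]) auto
  have contF: "continuous_on {0..T} ?F"
    by (intro indefinite_integral_continuous_1 integrable_continuous_interval contT)
  have "((\<lambda>t. exp (c * t) * f t + c * (exp (c * t) * ?F t)) has_integral
      exp (c * T) * ?F T - exp (c * 0) * ?F 0) {0..T}"
    by (rule fundamental_theorem_of_calculus[OF \<open>T \<ge> 0\<close>])
      (auto intro!: derivative_eq_intros integral_has_real_derivative[OF contT]
        simp: has_real_derivative_iff_has_vector_derivative[symmetric] algebra_simps)
  moreover have "((\<lambda>t. exp (c * t) * f t + c * (exp (c * t) * ?F t)) has_integral
      integral {0..T} (\<lambda>t. exp (c * t) * f t) + c * integral {0..T} (\<lambda>t. exp (c * t) * ?F t)) {0..T}"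
    by (intro has_integral_add has_integral_mult_right integrable_integral
        integrable_continuous_interval continuous_intros contT contF)
  ultimately show ?thesis by (auto dest: has_integral_unique)
qed
text \<open>Continuity at \<open>x\<close> is decided inside \<open>{a..x+1}\<close>, so compact
  intervals suffice.\<close>

lemma continuous_on_atLeastI:
  fixes f :: "real \<Rightarrow> 'a::topological_space"
  assumes "\<And>T. continuous_on {a..T} f"
  shows "continuous_on {a..} f"
  unfolding continuous_on_eq_continuous_within
proof
  fix x assume x: "x \<in> {a..}"
  have "continuous (at x within {a..x+1}) f"
    using assms[of "x + 1"] x by (auto simp: continuous_on_eq_continuous_within)
  moreover have "at x within {a..x+1} = at x within {a..}"
    by (rule at_within_nhd[of x "{..<x+1}"]) auto
  ultimately show "continuous (at x within {a..}) f" by simp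
qed

lemma continuous_on_atLeast_integral:
  fixes f :: "real \<Rightarrow> real"
  assumes "continuous_on {a..} f"
  shows "continuous_on {a..} (\<lambda>t. integral {a..t} f)"
  by (intro continuous_on_atLeastI indefinite_integral_continuous_1 integrable_continuous_interval
        continuous_on_subset[OF assms]) auto

lemma continuous_bounded_of_tendsto_at_top:
  fixes f :: "real \<Rightarrow> real"
  assumes cont: "continuous_on {a..} f" and lim: "(f \<longlongrightarrow> l) at_top"
  obtains B where "B \<ge> 0" "\<And>t. t \<ge> a \<Longrightarrow> \<bar>f t\<bar> \<le> B"
proof -
  have "\<forall>\<^sub>F t in at_top. dist (f t) l < 1"
    using lim by (auto simp: tendsto_iff)
  then obtain T where T: "\<And>t. t \<ge> T \<Longrightarrow> dist (f t) l < 1"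
    by (auto simp: eventually_at_top_linorder)
  have "bounded (f ` {a..T})"
    by (intro compact_imp_bounded compact_continuous_image continuous_on_subset[OF cont]) auto
  then obtain C where C: "\<And>t. t \<in> {a..T} \<Longrightarrow> \<bar>f t\<bar> \<le> C"
    unfolding bounded_iff by fastforce
  show ?thesis
  proof (rule that[of "max C (\<bar>l\<bar> + 1)"])
    fix t assume "t \<ge> a"
    thus "\<bar>f t\<bar> \<le> max C (\<bar>l\<bar> + 1)"
      using T[of t] C[of t] by (cases "t \<le> T") (auto simp: dist_real_def)
  qed auto
qed

lemma integral_exponential_bound:
  assumes cont: "continuous_on {0..} f" and lap: "has_laplace f M r" and "r > 0"
  obtains K where "K \<ge> 0" "\<And>t. t \<ge> 0 \<Longrightarrow> \<bar>integral {0..t} f\<bar> \<le> K * exp (r * t)"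
proof -
  define H where "H t = integral {0..t} (\<lambda>u. exp (- (r * u)) * f u)" for t
  have contg: "continuous_on {0..} (\<lambda>u. exp (- (r * u)) * f u)"
    by (intro continuous_intros cont)
  have contH: "continuous_on {0..} H"
    unfolding H_def by (rule continuous_on_atLeast_integral[OF contg])
  have "(H \<longlongrightarrow> M) at_top"
    using lap unfolding has_laplace_iff_tendsto[OF cont] H_def .
  from continuous_bounded_of_tendsto_at_top[OF contH this]
  obtain B where B: "B \<ge> 0" "\<And>t. t \<ge> 0 \<Longrightarrow> \<bar>H t\<bar> \<le> B" by blast
  show ?thesis
  \<comment> \<open>One \<open>B\<close> bounds the boundary term \<open>exp (r * t) * H t\<close>,
    the other the remaining integral, since \<open>r\<close> times the integral of
    \<open>exp (r * u)\<close> over \<open>{0..t}\<close> is at most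
    \<open>exp (r * t)\<close>.\<close>
  proof (rule that[of "2 * B"])
    fix t :: real assume t: "t \<ge> 0"
    have "((\<lambda>u. exp (r * u)) has_integral exp (r * t) / r - exp (r * 0) / r) {0..t}"
      by (rule fundamental_theorem_of_calculus[OF t])
        (use \<open>r > 0\<close> in \<open>auto intro!: derivative_eq_intros
          simp: has_real_derivative_iff_has_vector_derivative[symmetric]\<close>)
    hence int_exp: "((\<lambda>u. exp (r * u) * B) has_integral (exp (r * t) / r - 1 / r) * B) {0..t}"
      by (intro has_integral_mult_left) simp
    have "norm (integral {0..t} (\<lambda>u. exp (r * u) * H u)) \<le> integral {0..t} (\<lambda>u. exp (r * u) * B)"
      by (rule integral_norm_bound_integral)
        (use B int_exp in \<open>auto simp: abs_mult has_integral_iff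
          intro!: integrable_continuous_interval continuous_intros continuous_on_subset[OF contH]\<close>)
    hence "\<bar>integral {0..t} (\<lambda>u. exp (r * u) * H u)\<bar> \<le> (exp (r * t) / r - 1 / r) * B"
      unfolding integral_unique[OF int_exp] by simp
    hence "r * \<bar>integral {0..t} (\<lambda>u. exp (r * u) * H u)\<bar> \<le> r * ((exp (r * t) / r - 1 / r) * B)"
      using \<open>r > 0\<close> by (intro mult_left_mono) auto
    also have "\<dots> = exp (r * t) * B - B" using \<open>r > 0\<close> by (simp add: field_simps)
    finally have 1: "\<bar>r * integral {0..t} (\<lambda>u. exp (r * u) * H u)\<bar> \<le> exp (r * t) * B"
      using \<open>r > 0\<close> B(1) by (simp add: abs_mult)
    have 2: "\<bar>exp (r * t) * H t\<bar> \<le> exp (r * t) * B"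
      using B(2)[OF t] by (simp add: abs_mult)
    \<comment> \<open>Integration by parts applied to \<open>exp (- (r * u)) * f u\<close>, whose
      primitive is \<open>H\<close>: the factor \<open>exp (r * u)\<close> undoes the
      damping.\<close>
    have "integral {0..t} f = exp (r * t) * H t - r * integral {0..t} (\<lambda>u. exp (r * u) * H u)"
      using integral_exp_mult_eq[OF contg t, of r]
      by (simp add: H_def mult.assoc[symmetric] exp_add[symmetric])
    with 1 2 show "\<bar>integral {0..t} f\<bar> \<le> 2 * B * exp (r * t)"
      by (simp add: algebra_simps)
  qed (use B in auto)
qed

text \<open>Integrating by parts up to \<open>T\<close> leaves the boundary term
  \<open>exp (- (s * T)) * integral {0..T} f\<close>. Its absolute value is at most
  \<open>K * exp (- ((s - r) * T))\<close>, which vanishes as \<open>T\<close> grows because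
  \<open>r < s\<close>.\<close>

lemma has_laplace_integral:
  assumes cont: "continuous_on {0..} f" and lap: "has_laplace f L s" and "s > 0"
    and bound: "\<And>t. t \<ge> 0 \<Longrightarrow> \<bar>integral {0..t} f\<bar> \<le> K * exp (r * t)" and "r < s"
  shows "has_laplace (\<lambda>t. integral {0..t} f) (L / s) s"
proof -
  let ?F = "\<lambda>t. integral {0..t} f"
  have "((\<lambda>T. exp (- (s * T)) * ?F T) \<longlongrightarrow> 0) at_top"
  proof (rule Lim_null_comparison)
    show "\<forall>\<^sub>F T in at_top. norm (exp (- (s * T)) * ?F T) \<le> K * exp (- ((s - r) * T))"
      using eventually_ge_at_top[of 0]
    proof eventually_elim
      case (elim T)
      have "exp (- (s * T)) * \<bar>?F T\<bar> \<le> exp (- (s * T)) * (K * exp (r * T))"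
        by (intro mult_left_mono bound elim) auto
      also have "\<dots> = K * exp (- ((s - r) * T))"
        by (simp add: mult_exp_exp left_diff_distrib)
      finally show ?case by (simp add: abs_mult)
    qed
    show "((\<lambda>T. K * exp (- ((s - r) * T))) \<longlongrightarrow> 0) at_top"
      by (intro tendsto_mult_right_zero filterlim_compose[OF exp_at_bot]
          filterlim_compose[OF filterlim_uminus_at_bot_at_top]
          filterlim_tendsto_pos_mult_at_top[OF tendsto_const] filterlim_ident)
        (use \<open>r < s\<close> in auto)
  qed
  moreover have "((\<lambda>T. integral {0..T} (\<lambda>t. exp (- (s * t)) * f t)) \<longlongrightarrow> L) at_top"
    using lap unfolding has_laplace_iff_tendsto[OF cont] .
  ultimately have lim: "((\<lambda>T. (integral {0..T} (\<lambda>t. exp (- (s * t)) * f t) - exp (- (s * T)) * ?F T) / s)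
      \<longlongrightarrow> (L - 0) / s) at_top"
    by (intro tendsto_intros) (use \<open>s > 0\<close> in auto)
  have "\<forall>\<^sub>F T in at_top. (integral {0..T} (\<lambda>t. exp (- (s * t)) * f t) - exp (- (s * T)) * ?F T) / s
      = integral {0..T} (\<lambda>t. exp (- (s * t)) * ?F t)"
    using eventually_ge_at_top[of 0]
  proof eventually_elim
    case (elim T)
    show ?case using integral_exp_mult_eq[OF cont elim, of "- s"] \<open>s > 0\<close> by (simp add: field_simps)
  qed
  with lim show ?thesis
    unfolding has_laplace_iff_tendsto[OF continuous_on_atLeast_integral[OF cont]]
    using Lim_transform_eventually by force
qed

section \<open>Moments on the unit interval and Lerch's theorem\<close>

text \<open>By linearity \<open>h\<close> is orthogonal to every polynomial \<open>p\<close>, so the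
  integral of \<open>h * h\<close> equals that of \<open>(h - p) * h\<close>. Weierstrass
  approximation makes the latter arbitrarily small, and a continuous nonnegative function with
  integral zero vanishes.\<close>

lemma orthogonal_monomials_imp_zero:
  fixes h :: "real \<Rightarrow> real"
  assumes cont: "continuous_on {0..1} h" and orth: "\<And>n. integral {0..1} (\<lambda>x. x ^ n * h x) = 0"
    and "x \<in> {0..1}"
  shows "h x = 0"
proof -
  have h_int: "(\<lambda>x. \<bar>h x\<bar>) integrable_on {0..1}"
    by (intro integrable_continuous_interval continuous_intros cont)
  define I where "I = integral {0..1} (\<lambda>x. \<bar>h x\<bar>)"
  have "I \<ge> 0" unfolding I_def by (intro integral_nonneg h_int) auto
  have hh_int: "(\<lambda>x. h x * h x) integrable_on {0..1}"
    by (intro integrable_continuous_interval continuous_intros cont)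
  have "integral {0..1} (\<lambda>x. h x * h x) \<le> 0"
  proof (rule field_le_epsilon)
    fix e :: real assume "e > 0"
    \<comment> \<open>The approximation error is scaled by \<open>I + 1\<close> instead of
      \<open>I\<close>, because \<open>I\<close> may be zero.\<close>
    hence "e / (I + 1) > 0" using \<open>I \<ge> 0\<close> by simp
    from Stone_Weierstrass_real_polynomial_function[OF _ cont this]
    obtain p where p: "real_polynomial_function p"
      "\<And>x. x \<in> {0..1} \<Longrightarrow> \<bar>h x - p x\<bar> < e / (I + 1)" by auto
    from p(1) obtain a n where p_eq: "p = (\<lambda>x. \<Sum>i\<le>n. a i * x ^ i)"
      by (auto simp: real_polynomial_function_iff_sum)
    have "((\<lambda>x. \<Sum>i\<le>n. a i * (x ^ i * h x)) has_integral (\<Sum>i\<le>n. a i * 0)) {0..1}"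
      by (intro has_integral_sum has_integral_mult_right)
        (auto simp: has_integral_iff orth
          intro!: integrable_continuous_interval continuous_intros cont)
    hence ph: "((\<lambda>x. p x * h x) has_integral 0) {0..1}"
      by (simp add: p_eq sum_distrib_right mult.assoc)
    have "((\<lambda>x. h x * h x - p x * h x) has_integral integral {0..1} (\<lambda>x. h x * h x) - 0) {0..1}"
      by (intro has_integral_diff ph integrable_integral hh_int)
    moreover have "((\<lambda>x. e / (I + 1) * \<bar>h x\<bar>) has_integral e / (I + 1) * I) {0..1}"
      unfolding I_def by (intro has_integral_mult_right integrable_integral h_int)
    moreover have "h x * h x - p x * h x \<le> e / (I + 1) * \<bar>h x\<bar>" if "x \<in> {0..1}" for x
    proof -
      have "h x * h x - p x * h x \<le> \<bar>h x - p x\<bar> * \<bar>h x\<bar>"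
        by (metis abs_ge_self abs_mult left_diff_distrib)
      also have "\<dots> \<le> e / (I + 1) * \<bar>h x\<bar>"
        using p(2)[OF that] by (intro mult_right_mono) auto
      finally show ?thesis .
    qed
    ultimately have "integral {0..1} (\<lambda>x. h x * h x) - 0 \<le> e / (I + 1) * I"
      by (rule has_integral_le)
    also have "\<dots> \<le> e" using \<open>e > 0\<close> \<open>I \<ge> 0\<close> by (simp add: field_simps)
    finally show "integral {0..1} (\<lambda>x. h x * h x) \<le> 0 + e" by simp
  qed
  moreover have "integral {0..1} (\<lambda>x. h x * h x) \<ge> 0"
    by (intro integral_nonneg hh_int) auto
  ultimately have "\<forall>x\<in>{0..1}. h x * h x = 0"
    by (subst integral_eq_0_iff[symmetric]) (auto intro!: continuous_intros cont)
  with assms show ?thesis by auto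
qed

text \<open>
  With \<open>x = exp (- t)\<close> the transforms become the moments of a function on the unit interval;
  the factor \<open>x powr (r + 1)\<close> in \<open>h\<close> makes it continuous at \<open>0\<close>.
\<close>

lemma has_laplace_zero_imp_zero:
  assumes cont: "continuous_on {0..} f"
    and bound: "\<And>t. t \<ge> 0 \<Longrightarrow> \<bar>f t\<bar> \<le> K * exp (r * t)"
    and lap: "\<And>s. s > r \<Longrightarrow> has_laplace f 0 s"
    and "t \<ge> 0"
  shows "f t = 0"
proof -
  define h where "h x = (if x \<le> 0 then 0 else x powr (r + 1) * f (- ln x))" for x
  have h_exp: "h (exp (- t)) = exp (- ((r + 1) * t)) * f t" for t
    by (simp add: h_def powr_def)
  \<comment> \<open>The growth bound on \<open>f\<close> becomes \<open>K * x powr (- r)\<close>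
    under \<open>x = exp (- t)\<close>; the exponent \<open>r + 1\<close> leaves one spare power of
    \<open>x\<close>, which forces the limit \<open>0\<close> at the origin.\<close>
  have h_le: "\<bar>h x\<bar> \<le> K * x" if "x \<in> {0..1}" for x
  proof (cases "x = 0")
    case False
    with that have x: "x > 0" "ln x \<le> 0" by auto
    have "\<bar>h x\<bar> = x powr (r + 1) * \<bar>f (- ln x)\<bar>" using x by (simp add: h_def abs_mult)
    also have "\<dots> \<le> x powr (r + 1) * (K * exp (r * (- ln x)))"
      using x by (intro mult_left_mono bound) auto
    also have "\<dots> = K * x" using x by (simp add: powr_def algebra_simps exp_add exp_minus field_simps)
    finally show ?thesis .
  qed (auto simp: h_def)
  have cont_h: "continuous_on {0..1} h"
    unfolding continuous_on_eq_continuous_within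
  proof
    fix x :: real assume x: "x \<in> {0..1}"
    show "continuous (at x within {0..1}) h"
    proof (cases "x = 0")
      case True
      have "(h \<longlongrightarrow> 0) (at 0 within {0..1})"
      proof (rule Lim_null_comparison)
        show "\<forall>\<^sub>F y in at 0 within {0..1}. norm (h y) \<le> K * y"
          using h_le by (auto simp: eventually_at_filter)
        have "((\<lambda>y. K * y) \<longlongrightarrow> K * 0) (at 0 within {0..1})" by (intro tendsto_intros)
        thus "((\<lambda>y. K * y) \<longlongrightarrow> 0) (at 0 within {0..1})" by simp
      qed
      thus ?thesis by (simp add: True continuous_within h_def)
    next
      case False
      with x have "x > 0" by auto
      have "continuous_on {0<..1} (\<lambda>x. x powr (r + 1) * f (- ln x))"
        by (intro continuous_intros continuous_on_compose2[OF cont]) auto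
      hence "continuous_on {0<..1} h"
        by (rule continuous_on_eq) (auto simp: h_def)
      hence "continuous (at x within {0<..1}) h"
        using x \<open>x > 0\<close> by (auto simp: continuous_on_eq_continuous_within)
      moreover have "at x within {0<..1} = at x within {0..1}"
        by (rule at_within_nhd[of x "{0<..}"]) (use \<open>x > 0\<close> in auto)
      ultimately show ?thesis by simp
    qed
  qed
  have orth: "integral {0..1} (\<lambda>x. x ^ n * h x) = 0" for n
  proof -
    let ?g = "\<lambda>x. x ^ n * h x"
    have cont_g: "continuous_on {0..1} ?g" by (intro continuous_intros cont_h)
    let ?J = "\<lambda>y. integral {y..1} ?g"
    \<comment> \<open>The shift \<open>r + n + 2\<close> collects \<open>n\<close> from the
      monomial, \<open>r + 1\<close> from \<open>h\<close> and \<open>1\<close> from the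
      differential of \<open>exp (- t)\<close>. It exceeds \<open>r\<close>, so the transform
      vanishes there.\<close>
    have sub: "integral {0..T} (\<lambda>t. exp (- ((r + real n + 2) * t)) * f t) = ?J (exp (- T))"
      if "T \<ge> 0" for T
    proof -
      \<comment> \<open>The map \<open>exp (- t)\<close> is decreasing, so the oriented integral on
        the right has its endpoints reversed. The first term runs over an empty or one-point
        interval and is zero; the second carries the minus sign removed below.\<close>
      have "((\<lambda>t. (- exp (- t)) *\<^sub>R ?g (exp (- t))) has_integral
          (integral {exp (- 0)..exp (- T)} ?g - integral {exp (- T)..exp (- 0)} ?g)) {0..T}"
        by (rule has_integral_substitution_general[of "{}" _ _ _ 0 1])
          (use that in \<open>auto intro!: cont_g continuous_intros derivative_eq_intros\<close>)
      moreover have "integral {1..exp (- T)} ?g = 0"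
        using that by (cases "T = 0") auto
      ultimately have "((\<lambda>t. - (- exp (- t) * ?g (exp (- t)))) has_integral - (- ?J (exp (- T)))) {0..T}"
        by (intro has_integral_neg) simp
      moreover have "- (- exp (- t) * ?g (exp (- t))) = exp (- ((r + real n + 2) * t)) * f t" for t
      proof -
        have "exp (- t) * exp (- t) ^ n * exp (- ((r + 1) * t)) = exp (- ((r + real n + 2) * t))"
          unfolding exp_of_nat_mult[symmetric] mult_exp_exp by (simp add: algebra_simps)
        thus ?thesis by (simp add: h_exp mult.assoc[symmetric])
      qed
      ultimately show ?thesis by (simp add: has_integral_iff)
    qed
    have "((\<lambda>T. integral {0..T} (\<lambda>t. exp (- ((r + real n + 2) * t)) * f t)) \<longlongrightarrow> 0) at_top"
      using lap[of "r + real n + 2"] unfolding has_laplace_iff_tendsto[OF cont] by simp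
    hence "((\<lambda>T. ?J (exp (- T))) \<longlongrightarrow> 0) at_top"
      by (rule Lim_transform_eventually) (rule eventually_mono[OF eventually_ge_at_top[of 0]], rule sub)
    \<comment> \<open>The same expression also tends to the full moment, by continuity of the
      integral in its lower endpoint; uniqueness of limits then makes the moment zero.\<close>
    moreover have "((\<lambda>T. ?J (exp (- T))) \<longlongrightarrow> ?J 0) at_top"
    proof (rule continuous_on_tendsto_compose[of "{0..1}" ?J])
      show "continuous_on {0..1} ?J"
        by (intro indefinite_integral_continuous_1' integrable_continuous_interval cont_g)
      show "((\<lambda>T. exp (- T)) \<longlongrightarrow> (0::real)) at_top"
        by (intro filterlim_compose[OF exp_at_bot] filterlim_uminus_at_bot_at_top)
      show "\<forall>\<^sub>F T in at_top. exp (- T) \<in> {0..1::real}"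
        using eventually_ge_at_top[of 0] by eventually_elim auto
    qed auto
    ultimately show ?thesis by (intro tendsto_unique[OF trivial_limit_at_top_linorder])
  qed
  have "h (exp (- t)) = 0"
    by (rule orthogonal_monomials_imp_zero[OF cont_h orth]) (use \<open>t \<ge> 0\<close> in auto)
  thus ?thesis by (simp add: h_exp)
qed

section \<open>The Prabhakar function with third parameter one: convergence, growth and
  transform\<close>

lemma prabhakar_one:
  fixes a b z :: real
  shows "prabhakar a b 1 z = (\<Sum>k. z ^ k / Gamma (a * real k + b))"
proof -
  have "Gamma (1 + real k) = fact k" for k
    using Gamma_fact[of k, where ?'a = real] by simp
  thus ?thesis by (simp add: prabhakar_def)
qed

text \<open>This is \<open>powr_le_Gamma_mult_exp\<close> at exponent \<open>a * k + b - 1\<close>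
  and argument \<open>r * t\<close>. The free scale \<open>r\<close> trades growth in
  \<open>t\<close> for decay in \<open>k\<close>: a large \<open>r\<close> makes the ratio of the
  geometric factor less than one.\<close>

lemma prabhakar_term_bound:
  fixes a b t r w :: real
  assumes "a > 0" "b \<ge> 1" "t \<ge> 0" "r > 0"
  shows "\<bar>t powr (b - 1) * ((w * t powr a) ^ k / Gamma (a * real k + b))\<bar>
    \<le> (\<bar>w\<bar> / r powr a) ^ k * (exp (r * t) / r powr (b - 1))"
\<comment> \<open>At \<open>t = 0\<close> the left-hand side is zero even for \<open>b = 1\<close>,
  because \<open>0 powr 0 = 0\<close>.\<close>
proof (cases "t = 0")
  case False
  with assms have t: "t > 0" by simp
  let ?e = "a * real k + b - 1"
  have "a * real k \<ge> 0" using assms by simp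
  hence e: "?e \<ge> 0" using \<open>b \<ge> 1\<close> by linarith
  have G: "Gamma (a * real k + b) > 0"
    by (rule Gamma_real_pos) (use e in linarith)
  have split: "x powr ?e = (x powr a) ^ k * x powr (b - 1)" if "x > 0" for x
    using that by (simp add: powr_powr powr_add[symmetric] powr_realpow[symmetric] algebra_simps)
  have "r powr ?e * t powr ?e \<le> Gamma (a * real k + b) * exp (r * t)"
    using powr_le_Gamma_mult_exp[OF e, of "r * t"] assms t by (simp add: powr_mult)
  hence "t powr ?e / Gamma (a * real k + b) \<le> exp (r * t) / r powr ?e"
    using G assms by (simp add: field_simps)
  hence "\<bar>w\<bar> ^ k * (t powr ?e / Gamma (a * real k + b)) \<le> \<bar>w\<bar> ^ k * (exp (r * t) / r powr ?e)"
    by (rule mult_left_mono) simp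
  thus ?thesis
    using G assms t by (simp add: split abs_mult power_mult_distrib power_abs power_divide mult_ac)
qed (use assms in auto)

lemma summable_prabhakar_one:
  fixes a b z :: real
  assumes "a > 0" "b \<ge> 1"
  shows "summable (\<lambda>k. z ^ k / Gamma (a * real k + b))"
proof (rule summable_comparison_test')
  \<comment> \<open>The scale is chosen so that \<open>r powr a\<close> exceeds the absolute value
    of \<open>z\<close>; the term bound at \<open>t = 1\<close> with \<open>w = z\<close> then gives
    a convergent geometric majorant.\<close>
  define r where "r = (\<bar>z\<bar> + 1) powr (1 / a)"
  have r: "r > 0" "r powr a = \<bar>z\<bar> + 1"
    using assms by (auto simp: r_def powr_powr)
  show "summable (\<lambda>k. (\<bar>z\<bar> / r powr a) ^ k * (exp (r * 1) / r powr (b - 1)))"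
    by (intro summable_mult2 summable_geometric) (simp add: r)
  show "norm (z ^ k / Gamma (a * real k + b)) \<le> (\<bar>z\<bar> / r powr a) ^ k * (exp (r * 1) / r powr (b - 1))" for k
    using prabhakar_term_bound[OF assms _ r(1), of 1 z k] by simp
qed

lemma continuous_on_prabhakar_one:
  fixes a b :: real
  assumes "a > 0" "b \<ge> 1" "continuous_on S g"
  shows "continuous_on S (\<lambda>x. prabhakar a b 1 (g x))"
proof -
  have "isCont (\<lambda>z. \<Sum>k. 1 / Gamma (a * real k + b) * z ^ k) z" for z
    using summable_prabhakar_one[OF assms(1,2)] by (intro isCont_powser_converges_everywhere) simp
  hence "continuous_on UNIV (\<lambda>z. prabhakar a b 1 z)"
    by (simp add: prabhakar_one continuous_on_eq_continuous_within)
  thus ?thesis by (rule continuous_on_compose2[OF _ assms(3)]) auto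
qed

text \<open>The bound does not depend on \<open>n\<close>. It therefore passes to the limit as a
  growth bound, and it also supplies the majorant for dominated convergence.\<close>

lemma prabhakar_partial_sum_bound:
  fixes a b t r w :: real
  assumes "a > 0" "b \<ge> 1" "t \<ge> 0" "r > 0" "\<bar>w\<bar> < r powr a"
  shows "\<bar>\<Sum>k<n. t powr (b - 1) * ((w * t powr a) ^ k / Gamma (a * real k + b))\<bar>
    \<le> 1 / ((1 - \<bar>w\<bar> / r powr a) * r powr (b - 1)) * exp (r * t)"
proof -
  let ?q = "\<bar>w\<bar> / r powr a"
  have q: "0 \<le> ?q" "?q < 1" using assms by auto
  have "\<bar>\<Sum>k<n. t powr (b - 1) * ((w * t powr a) ^ k / Gamma (a * real k + b))\<bar>
      \<le> (\<Sum>k<n. ?q ^ k * (exp (r * t) / r powr (b - 1)))"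
    by (rule order_trans[OF sum_abs]) (intro sum_mono prabhakar_term_bound assms)
  also have "\<dots> = (\<Sum>k<n. ?q ^ k) * (exp (r * t) / r powr (b - 1))"
    by (rule sum_distrib_right[symmetric])
  also have "\<dots> \<le> (\<Sum>k. ?q ^ k) * (exp (r * t) / r powr (b - 1))"
    using q by (intro mult_right_mono sum_le_suminf summable_geometric) auto
  also have "(\<Sum>k. ?q ^ k) = 1 / (1 - ?q)"
    using q by (intro suminf_geometric) auto
  finally show ?thesis by simp
qed

lemma sums_prabhakar_one:
  fixes a b t w :: real
  assumes "a > 0" "b \<ge> 1"
  shows "(\<lambda>k. t powr (b - 1) * ((w * t powr a) ^ k / Gamma (a * real k + b))) sums
    (t powr (b - 1) * prabhakar a b 1 (w * t powr a))"
  unfolding prabhakar_one by (intro sums_mult summable_sums summable_prabhakar_one assms)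

lemma prabhakar_exponential_bound:
  fixes a b t r w :: real
  assumes "a > 0" "b \<ge> 1" "t \<ge> 0" "r > 0" "\<bar>w\<bar> < r powr a"
  shows "\<bar>t powr (b - 1) * prabhakar a b 1 (w * t powr a)\<bar>
    \<le> 1 / ((1 - \<bar>w\<bar> / r powr a) * r powr (b - 1)) * exp (r * t)"
proof (rule tendsto_upperbound)
  show "(\<lambda>n. \<bar>\<Sum>k<n. t powr (b - 1) * ((w * t powr a) ^ k / Gamma (a * real k + b))\<bar>)
      \<longlonglongrightarrow> \<bar>t powr (b - 1) * prabhakar a b 1 (w * t powr a)\<bar>"
    using sums_prabhakar_one[OF assms(1,2)] unfolding sums_def by (rule tendsto_rabs)
qed (use prabhakar_partial_sum_bound[OF assms] in auto)

lemma has_laplace_prabhakar_term: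
  fixes a b s w :: real
  assumes "a > 0" "b > 0" "s > 0"
  shows "has_laplace (\<lambda>t. t powr (b - 1) * ((w * t powr a) ^ k / Gamma (a * real k + b)))
    ((w / s powr a) ^ k * s powr (- b)) s"
proof -
  let ?G = "Gamma (a * real k + b)"
  have pos: "a * real k + b > 0" using assms by (simp add: add_nonneg_pos)
  hence G: "?G > 0" by (rule Gamma_real_pos)
  have lap: "has_laplace (\<lambda>t. w ^ k / ?G * t powr (a * real k + b - 1))
      (w ^ k / ?G * (?G / s powr (a * real k + b))) s"
    using has_laplace_powr[of "a * real k + b - 1" s] pos \<open>s > 0\<close>
    by (intro has_laplace_mult_right) simp
  have val: "w ^ k / ?G * (?G / s powr (a * real k + b)) = (w / s powr a) ^ k * s powr (- b)"
  proof -
    have "s powr (a * real k + b) = (s powr a) ^ k * s powr b"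
      using \<open>s > 0\<close> by (simp add: powr_add powr_powr powr_realpow[symmetric])
    thus ?thesis
      using G by (simp add: powr_minus_divide power_divide)
  qed
  have cong: "w ^ k / ?G * t powr (a * real k + b - 1)
      = t powr (b - 1) * ((w * t powr a) ^ k / ?G)" if "t \<ge> 0" for t
  proof (cases "t = 0")
    case False
    with that show ?thesis
      by (simp add: power_mult_distrib powr_powr powr_realpow[symmetric] powr_add[symmetric] algebra_simps)
  qed simp
  show ?thesis
    using lap unfolding val by (rule has_laplace_cong[THEN iffD1, rotated]) (rule cong)
qed

text \<open>Dominated convergence allows termwise transformation: the damped partial sums stay below
  a multiple of \<open>exp (- (s - r) * t)\<close>. The transformed terms form a geometric series,
  convergent since the absolute value of \<open>w\<close> is below \<open>r powr a\<close>, hence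
  below \<open>s powr a\<close>.\<close>

lemma has_laplace_prabhakar_one:
  fixes a b r s w :: real
  assumes "a > 0" "b \<ge> 1" "0 < r" "r < s" "\<bar>w\<bar> < r powr a"
  shows "has_laplace (\<lambda>t. t powr (b - 1) * prabhakar a b 1 (w * t powr a))
    (s powr (- b) / (1 - w / s powr a)) s"
proof -
  define f where "f k t = t powr (b - 1) * ((w * t powr a) ^ k / Gamma (a * real k + b))" for k t
  define F where "F t = t powr (b - 1) * prabhakar a b 1 (w * t powr a)" for t
  define L where "L k = (w / s powr a) ^ k * s powr (- b)" for k
  define C where "C = 1 / ((1 - \<bar>w\<bar> / r powr a) * r powr (b - 1))"
  have "((\<lambda>t. exp (- (s * t)) * f k t) has_integral L k) {0..}" for k
    using has_laplace_prabhakar_term[of a b s w k] assms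
    by (simp add: has_laplace_def f_def L_def)
  hence part: "((\<lambda>t. exp (- (s * t)) * (\<Sum>k<n. f k t)) has_integral (\<Sum>k<n. L k)) {0..}" for n
    unfolding sum_distrib_left by (intro has_integral_sum) auto
  have dom: "(\<lambda>t. C * exp (- (s - r) * t)) integrable_on {0..}"
    using has_integral_exp_minus_to_infinity[of "s - r" 0] assms
    by (intro integrable_on_mult_right) (auto simp: has_integral_iff)
  have le: "norm (exp (- (s * t)) * (\<Sum>k<n. f k t)) \<le> C * exp (- (s - r) * t)" if "t \<in> {0..}" for n t
  proof -
    have "\<bar>\<Sum>k<n. f k t\<bar> \<le> C * exp (r * t)"
      unfolding f_def C_def by (rule prabhakar_partial_sum_bound) (use assms that in auto)
    hence "exp (- (s * t)) * \<bar>\<Sum>k<n. f k t\<bar> \<le> exp (- (s * t)) * (C * exp (r * t))"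
      by (rule mult_left_mono) simp
    also have "\<dots> = C * exp (- (s - r) * t)" by (simp add: mult_exp_exp left_diff_distrib)
    finally show ?thesis by (simp add: abs_mult)
  qed
  have lim: "(\<lambda>n. exp (- (s * t)) * (\<Sum>k<n. f k t)) \<longlonglongrightarrow> exp (- (s * t)) * F t" for t
    using sums_prabhakar_one[OF assms(1,2), of t w]
    unfolding sums_def f_def F_def by (rule tendsto_mult_left)
  note dc = dominated_convergence[OF has_integral_integrable[OF part] dom le lim]
  have "(\<lambda>n. \<Sum>k<n. L k) \<longlonglongrightarrow> integral {0..} (\<lambda>t. exp (- (s * t)) * F t)"
    using dc(2) by (simp add: integral_unique[OF part])
  moreover have "r powr a < s powr a" using assms by (simp add: powr_less_mono2)
  hence "L sums (1 / (1 - w / s powr a) * s powr (- b))"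
    unfolding L_def using assms by (intro sums_mult2 geometric_sums) simp
  hence "(\<lambda>n. \<Sum>k<n. L k) \<longlonglongrightarrow> s powr (- b) / (1 - w / s powr a)"
    by (simp add: sums_def)
  ultimately have "integral {0..} (\<lambda>t. exp (- (s * t)) * F t) = s powr (- b) / (1 - w / s powr a)"
    by (rule LIMSEQ_unique)
  with dc(1) show ?thesis
    by (simp add: has_laplace_def has_integral_iff F_def)
qed

section \<open>Comparison of the transforms of both sides\<close>

theorem mainTheorem4:
  fixes \<Lambda>\<^sub>0 \<alpha> \<gamma> \<beta> :: real and lam :: "real \<Rightarrow> real"
  assumes "\<Lambda>\<^sub>0 > 0" and "0 < \<alpha>" and "\<alpha> < 1" and "\<gamma> > 0" and "0 < \<beta>" and "\<beta> < 1"
    and "expected_intensity \<Lambda>\<^sub>0 \<alpha> \<gamma> \<beta> lam"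
  shows "\<forall>t\<ge>0. expected_events lam t =
    \<Lambda>\<^sub>0 / (1 - \<alpha>) * t
      - \<alpha> * \<Lambda>\<^sub>0 / (1 - \<alpha>) * t * prabhakar \<beta> 2 1 ((\<alpha> - 1) * \<gamma> * t powr \<beta>)"
proof -
  let ?L = "hawkes_laplace \<Lambda>\<^sub>0 \<alpha> \<gamma> \<beta>" and ?w = "(\<alpha> - 1) * \<gamma>"
  let ?A = "\<Lambda>\<^sub>0 / (1 - \<alpha>)" and ?B = "\<alpha> * \<Lambda>\<^sub>0 / (1 - \<alpha>)"
  let ?F = "\<lambda>t. integral {0..t} lam"
  let ?P = "\<lambda>t. prabhakar \<beta> 2 1 (?w * t powr \<beta>)"
  \<comment> \<open>Writing \<open>t powr (2 - 1)\<close> for \<open>t\<close> matches the transform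
    rules at \<open>a = 1\<close> and \<open>b = 2\<close>; the two agree for nonnegative
    \<open>t\<close>.\<close>
  define G where "G t = ?A * t powr (2 - 1) - ?B * (t powr (2 - 1) * ?P t)" for t
  from assms(7) have cont: "continuous_on {0..} lam"
    and "\<forall>\<^sub>F s in at_top. has_laplace lam (?L s) s"
    by (auto simp: expected_intensity_def)
  then obtain s\<^sub>0 where s\<^sub>0: "\<And>s. s \<ge> s\<^sub>0 \<Longrightarrow> has_laplace lam (?L s) s"
    by (auto simp: eventually_at_top_linorder)
  \<comment> \<open>The entry \<open>1\<close> gives positivity and
    \<open>t \<le> exp (r * t)\<close>, \<open>s\<^sub>0\<close> makes the transform of
    \<open>lam\<close> available at and beyond \<open>r\<close>, and the last entry puts
    \<open>r powr \<beta>\<close> above the absolute value of \<open>?w\<close>.\<close>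
  define r where "r = max (max 1 s\<^sub>0) ((\<bar>?w\<bar> + 1) powr (1 / \<beta>))"
  have r: "r \<ge> 1" "r \<ge> s\<^sub>0" by (auto simp: r_def)
  have "((\<bar>?w\<bar> + 1) powr (1 / \<beta>)) powr \<beta> \<le> r powr \<beta>"
    using \<open>0 < \<beta>\<close> by (intro powr_mono2) (auto simp: r_def)
  hence w: "\<bar>?w\<bar> < r powr \<beta>" using \<open>0 < \<beta>\<close> by (simp add: powr_powr)
  have "0 < r" using r by simp
  from integral_exponential_bound[OF cont s\<^sub>0[OF r(2)] this]
  obtain K where K: "\<And>t. t \<ge> 0 \<Longrightarrow> \<bar>?F t\<bar> \<le> K * exp (r * t)" by blast
  define C where "C = 1 / ((1 - \<bar>?w\<bar> / r powr \<beta>) * r powr (2 - 1))"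
  have contG: "continuous_on {0..} G"
  proof -
    have "continuous_on {0..} (\<lambda>t. ?A * t - ?B * (t * ?P t))"
      using \<open>0 < \<beta>\<close> by (intro continuous_intros continuous_on_prabhakar_one continuous_on_powr') auto
    thus ?thesis by (rule continuous_on_eq) (simp add: G_def)
  qed
  have lapG: "has_laplace G (?L s / s) s" if "s > r" for s
  proof -
    have "s > 0" using that r by simp
    have "r powr \<beta> < s powr \<beta>" using that \<open>0 < r\<close> \<open>0 < \<beta>\<close> by (simp add: powr_less_mono2)
    with w have "s powr \<beta> - ?w > 0" by linarith
    have "has_laplace G (?A * (Gamma (2 - 1 + 1) / s powr (2 - 1 + 1))
        - ?B * (s powr (- 2) / (1 - ?w / s powr \<beta>))) s"
      unfolding G_def using that \<open>s > 0\<close> \<open>0 < r\<close> \<open>0 < \<beta>\<close> w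
      by (intro has_laplace_diff has_laplace_mult_right has_laplace_powr has_laplace_prabhakar_one) auto
    \<comment> \<open>Here \<open>s powr \<beta> - ?w\<close> is the denominator in
      \<open>hawkes_laplace\<close>. Over it the two fractions combine to the numerator
      \<open>(1 - \<alpha>) * (\<gamma> + s powr \<beta>)\<close>, whose first factor cancels the
      one in \<open>?A\<close> and \<open>?B\<close>.\<close>
    moreover have "?A * (Gamma (2 - 1 + 1) / s powr (2 - 1 + 1))
        - ?B * (s powr (- 2) / (1 - ?w / s powr \<beta>)) = ?L s / s"
    proof -
      have "s powr \<beta> > 0" using \<open>s > 0\<close> by simp
      moreover have "(1 - \<alpha>) * \<gamma> + s powr \<beta> > 0"
        using \<open>s powr \<beta> - ?w > 0\<close> by (simp add: algebra_simps)
      moreover have "1 - ?w / s powr \<beta> = ((1 - \<alpha>) * \<gamma> + s powr \<beta>) / s powr \<beta>"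
        using \<open>s powr \<beta> > 0\<close> by (simp add: field_simps)
      moreover have "s powr (- 2) = 1 / s\<^sup>2" "s powr 2 = s\<^sup>2"
        using \<open>s > 0\<close> by (simp_all add: powr_minus divide_inverse)
      moreover have "Gamma (2 :: real) = 1"
        using Gamma_fact[of 1, where ?'a = real] by simp
      ultimately show ?thesis
        using \<open>s > 0\<close> \<open>\<alpha> < 1\<close> by (simp add: hawkes_laplace_def divide_simps) (simp add: algebra_simps power2_eq_square)
    qed
    ultimately show ?thesis by simp
  qed
  have boundG: "\<bar>G t\<bar> \<le> (\<bar>?A\<bar> + \<bar>?B\<bar> * C) * exp (r * t)" if "t \<ge> 0" for t
  proof -
    have "t \<le> exp t" using exp_ge_add_one_self[of t] by linarith
    also have "\<dots> \<le> exp (r * t)" using r that by (simp add: mult_le_cancel_right1)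
    finally have "\<bar>?A * t powr (2 - 1)\<bar> \<le> \<bar>?A\<bar> * exp (r * t)"
      unfolding abs_mult using that by (intro mult_left_mono) auto
    moreover have "\<bar>?B * (t powr (2 - 1) * ?P t)\<bar> \<le> \<bar>?B\<bar> * (C * exp (r * t))"
      unfolding abs_mult[of ?B] C_def using \<open>0 < \<beta>\<close> \<open>0 < r\<close> w that
      by (intro mult_left_mono prabhakar_exponential_bound) auto
    ultimately have "\<bar>G t\<bar> \<le> \<bar>?A\<bar> * exp (r * t) + \<bar>?B\<bar> * (C * exp (r * t))"
      unfolding G_def by linarith
    thus ?thesis by (simp add: distrib_right mult.assoc)
  qed
  have "?F t - G t = 0" if "t \<ge> 0" for t
  proof (rule has_laplace_zero_imp_zero[OF _ _ _ that])
    show "continuous_on {0..} (\<lambda>t. ?F t - G t)"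
      by (intro continuous_on_diff continuous_on_atLeast_integral cont contG)
    show "\<bar>?F t - G t\<bar> \<le> (K + (\<bar>?A\<bar> + \<bar>?B\<bar> * C)) * exp (r * t)" if "t \<ge> 0" for t
      using K[OF that] boundG[OF that] unfolding distrib_right[of K] by linarith
    show "has_laplace (\<lambda>t. ?F t - G t) 0 s" if "s > r" for s
    proof -
      have "has_laplace ?F (?L s / s) s"
        by (rule has_laplace_integral[OF cont s\<^sub>0 _ K]) (use that r in auto)
      from has_laplace_diff[OF this lapG[OF that]] show ?thesis by simp
    qed
  qed
  thus ?thesis by (simp add: expected_events_def G_def mult.assoc)
qed

end
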